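(* Let $t_0<t_1$ be real numbers, let $X\neq\{0\}$ be a Banach space, and let $1\le p\le\infty$. The Riemann-Liouville fractional integral, as an operator from $L^p(t_0,t_1;X)$ into itself, is not uniformly continuous when $\alpha\to0^+$; that is, it is not true that $$\lim_{\alpha\to0^+}\big\|J^\alpha_{t_0,t}-Id\big\|_{\mathcal{L}(L^p(t_0,t_1;X))}=0.$$
   Context: $L^p(t_0,t_1;X)$ is the Bochner-Lebesgue space on $[t_0,t_1]$ with its usual norm. For $\alpha>0$, $J^\alpha_{t_0,t}$ is the bounded linear operator from $L^p(t_0,t_1;X)$ into itself sending $f$ to the (a.e. defined) function $t\mapsto J^\alpha_{t_0,t}f(t):=\frac{1}{\Gamma(\alpha)}\int_{t_0}^t(t-s)^{\alpha-1}f(s)\,ds$ (Bochner integral). $Id$ is the identity operator, and $\mathcal{L}(Y)$ is the space of bounded linear operators on $Y$ with the operator norm. *)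

theory Defs
  imports "HOL-Analysis.Analysis" "HOL-Probability.Essential_Supremum"
begin

section \<open>Bochner integral in arbitrary Banach spaces\<close>

text \<open>
  The library's Bochner integral \<^term>\<open>lebesgue_integral\<close> is restricted to second-countable
  value types, i.e. to separable Banach spaces. The definitions below drop that restriction;
  Borel measurability, which is too weak for non-separable ranges, is replaced by
  strong (Bochner) measurability.
\<close>

definition strongly_measurable :: "'a measure \<Rightarrow> ('a \<Rightarrow> 'b::real_normed_vector) \<Rightarrow> bool" where
  "strongly_measurable M f \<longleftrightarrow>
     (\<exists>s. (\<forall>i::nat. simple_function M (s i)) \<and> (AE x in M. (\<lambda>i. s i x) \<longlonglongrightarrow> f x))"

definition has_bochner :: "'a measure \<Rightarrow> ('a \<Rightarrow> 'b::real_normed_vector) \<Rightarrow> 'b \<Rightarrow> bool" where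
  "has_bochner M f I \<longleftrightarrow> strongly_measurable M f \<and>
     (\<exists>s. (\<forall>i::nat. Bochner_Integration.simple_bochner_integrable M (s i)) \<and>
          (\<lambda>i. \<integral>\<^sup>+x. ennreal (norm (f x - s i x)) \<partial>M) \<longlonglongrightarrow> 0 \<and>
          (\<lambda>i. Bochner_Integration.simple_bochner_integral M (s i)) \<longlonglongrightarrow> I)"

definition bochner_integral :: "'a measure \<Rightarrow> ('a \<Rightarrow> 'b::real_normed_vector) \<Rightarrow> 'b" where
  "bochner_integral M f = (if \<exists>I. has_bochner M f I then THE I. has_bochner M f I else 0)"

lemma simple_function_norm_diff:
  fixes s t :: "'a \<Rightarrow> 'b::real_normed_vector"
  assumes "simple_function M s" "simple_function M t"
  shows "simple_function M (\<lambda>x. norm (s x - t x))"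
  using simple_function_compose2[OF assms, of "\<lambda>a b. norm (a - b)"] .

lemma strongly_measurable_norm_diff:
  assumes "strongly_measurable M f"
  obtains f' where "AE x in M. f x = f' x"
    "\<And>t. simple_function M t \<Longrightarrow> (\<lambda>x. norm (f' x - t x)) \<in> borel_measurable M"
proof -
  obtain s where s: "\<And>i::nat. simple_function M (s i)" "AE x in M. (\<lambda>i. s i x) \<longlonglongrightarrow> f x"
    using assms unfolding strongly_measurable_def by blast
  obtain N where N: "N \<in> null_sets M" "{x \<in> space M. \<not> (\<lambda>i. s i x) \<longlonglongrightarrow> f x} \<subseteq> N"
    using s(2) unfolding eventually_ae_filter by blast
  define s' where "s' i x = (if x \<in> N then 0 else s i x)" for i x
  define f' where "f' x = (if x \<in> N then 0 else f x)" for x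
  have "{x \<in> space M. x \<in> N} = N"
    using N(1) null_setsD2 sets.sets_into_space by fast
  then have s': "simple_function M (s' i)" for i
    using simple_function_If[of M "\<lambda>_. 0" "s i" "\<lambda>x. x \<in> N"] s(1) N(1)
    unfolding s'_def by auto
  have lim: "(\<lambda>i. s' i x) \<longlonglongrightarrow> f' x" if "x \<in> space M" for x
    using N(2) that unfolding s'_def f'_def by (cases "x \<in> N") auto
  have "AE x in M. f x = f' x"
    using AE_not_in[OF N(1)] by eventually_elim (simp add: f'_def)
  moreover have "(\<lambda>x. norm (f' x - t x)) \<in> borel_measurable M" if "simple_function M t" for t
  proof (rule borel_measurable_LIMSEQ_metric)
    show "(\<lambda>x. norm (s' i x - t x)) \<in> borel_measurable M" for i
      by (intro borel_measurable_simple_function simple_function_norm_diff s' that)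
    show "(\<lambda>i. norm (s' i x - t x)) \<longlonglongrightarrow> norm (f' x - t x)" if "x \<in> space M" for x
      by (intro tendsto_intros lim that)
  qed
  ultimately show ?thesis using that by blast
qed

lemma has_bochner_unique:
  assumes "has_bochner M f I" "has_bochner M f J"
  shows "I = J"
proof -
  let ?S = "Bochner_Integration.simple_bochner_integral M"
  obtain s where s: "\<And>i. Bochner_Integration.simple_bochner_integrable M (s i)"
      "(\<lambda>i. \<integral>\<^sup>+x. ennreal (norm (f x - s i x)) \<partial>M) \<longlonglongrightarrow> 0"
      "(\<lambda>i. ?S (s i)) \<longlonglongrightarrow> I"
    using assms(1) unfolding has_bochner_def by blast
  obtain t where t: "\<And>i. Bochner_Integration.simple_bochner_integrable M (t i)"
      "(\<lambda>i. \<integral>\<^sup>+x. ennreal (norm (f x - t i x)) \<partial>M) \<longlonglongrightarrow> 0"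
      "(\<lambda>i. ?S (t i)) \<longlonglongrightarrow> J"
    using assms(2) unfolding has_bochner_def by blast
  have sm: "strongly_measurable M f" using assms(1) by (simp add: has_bochner_def)
  obtain f' where f': "AE x in M. f x = f' x"
      "\<And>t. simple_function M t \<Longrightarrow> (\<lambda>x. norm (f' x - t x)) \<in> borel_measurable M"
    using strongly_measurable_norm_diff[OF sm] by blast
  have sf: "simple_function M (s i)" "simple_function M (t i)" for i
    using s(1) t(1) by (auto elim: simple_bochner_integrable.cases)
  have eq: "(\<integral>\<^sup>+x. ennreal (norm (f x - u x)) \<partial>M) = (\<integral>\<^sup>+x. ennreal (norm (f' x - u x)) \<partial>M)" for u
    using f'(1) by (intro nn_integral_cong_AE) auto
  have bound: "ennreal (norm (?S (s i) - ?S (t i)))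
      \<le> (\<integral>\<^sup>+x. ennreal (norm (f x - s i x)) \<partial>M) + (\<integral>\<^sup>+x. ennreal (norm (f x - t i x)) \<partial>M)" for i
  proof -
    have st: "Bochner_Integration.simple_bochner_integrable M (\<lambda>x. s i x - t i x)"
      using s(1) t(1) by (intro simple_bochner_integrable_compose2[where p="\<lambda>a b. a - b"]) auto
    have nst: "Bochner_Integration.simple_bochner_integrable M (\<lambda>x. norm (s i x - t i x))"
      using s(1) t(1) by (intro simple_bochner_integrable_compose2[where p="\<lambda>a b. norm (a - b)"]) auto
    have "norm (?S (s i) - ?S (t i))
        \<le> ?S (\<lambda>x. norm (s i x - t i x))"
      using simple_bochner_integral_norm_bound[OF st] simple_bochner_integral_diff[OF s(1) t(1)]
      by simp
    then have "ennreal (norm (?S (s i) - ?S (t i)))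
        \<le> (\<integral>\<^sup>+x. ennreal (norm (s i x - t i x)) \<partial>M)"
      by (subst simple_bochner_integral_eq_nn_integral[OF nst, symmetric]) (auto intro: ennreal_leI)
    also have "\<dots> \<le> (\<integral>\<^sup>+x. ennreal (norm (f' x - s i x)) + ennreal (norm (f' x - t i x)) \<partial>M)"
    proof (intro nn_integral_mono)
      fix x
      have "norm (s i x - t i x) \<le> norm (f' x - s i x) + norm (f' x - t i x)"
        using norm_triangle_ineq4[of "f' x - t i x" "f' x - s i x"] by simp
      then show "ennreal (norm (s i x - t i x))
          \<le> ennreal (norm (f' x - s i x)) + ennreal (norm (f' x - t i x))"
        by (simp flip: ennreal_plus add: ennreal_leI)
    qed
    also have "\<dots> = (\<integral>\<^sup>+x. ennreal (norm (f' x - s i x)) \<partial>M) + (\<integral>\<^sup>+x. ennreal (norm (f' x - t i x)) \<partial>M)"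
      using f'(2) sf by (intro nn_integral_add) auto
    finally show ?thesis by (simp only: eq)
  qed
  have "(\<lambda>i. ennreal (norm (?S (s i) - ?S (t i))))
      \<longlonglongrightarrow> 0"
  proof (rule tendsto_sandwich[OF _ _ tendsto_const])
    show "(\<lambda>i. (\<integral>\<^sup>+x. ennreal (norm (f x - s i x)) \<partial>M) + (\<integral>\<^sup>+x. ennreal (norm (f x - t i x)) \<partial>M))
        \<longlonglongrightarrow> 0"
      using tendsto_add[OF s(2) t(2)] by simp
  qed (use bound in \<open>simp_all add: always_eventually\<close>)
  moreover have "(\<lambda>i. ennreal (norm (?S (s i) - ?S (t i))))
      \<longlonglongrightarrow> ennreal (norm (I - J))"
    by (intro tendsto_intros s(3) t(3))
  ultimately have "ennreal (norm (I - J)) = 0"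
    using LIMSEQ_unique by blast
  then show ?thesis by simp
qed

lemma bochner_integral_eq:
  assumes "has_bochner M f I"
  shows "bochner_integral M f = I"
proof -
  have "(THE J. has_bochner M f J) = I"
    by (rule the_equality) (fact assms, erule has_bochner_unique[OF _ assms])
  moreover have "\<exists>J. has_bochner M f J"
    using assms by (rule exI)
  ultimately show ?thesis
    by (simp only: bochner_integral_def if_True simp_thms)
qed

lemma bochner_integral_eq_lebesgue_integral:
  fixes f :: "'a \<Rightarrow> 'b::{banach, second_countable_topology}"
  assumes "integrable M f"
  shows "bochner_integral M f = integral\<^sup>L M f"
proof (rule bochner_integral_eq)
  have "has_bochner_integral M f (integral\<^sup>L M f)"
    using assms by (rule has_bochner_integral_integrable)
  then show "has_bochner M f (integral\<^sup>L M f)"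
  proof cases
    case (1 s)
    from borel_measurable_implies_sequence_metric[OF 1(1), of 0]
    obtain u where u: "\<forall>i. simple_function M (u i)" "\<forall>x\<in>space M. (\<lambda>i. u i x) \<longlonglongrightarrow> f x"
      by blast
    have "AE x in M. (\<lambda>i. u i x) \<longlonglongrightarrow> f x"
      using u(2) by (intro AE_I2) blast
    with u(1) have "strongly_measurable M f"
      unfolding strongly_measurable_def by blast
    moreover have "(\<lambda>i. \<integral>\<^sup>+x. ennreal (norm (f x - s i x)) \<partial>M) \<longlonglongrightarrow> 0"
      using 1(3) .
    ultimately show ?thesis
      unfolding has_bochner_def using 1(2,4) by blast
  qed
qed

lemma bochner_integral_cong_AE:
  assumes "AE x in M. f x = g x"
  shows "bochner_integral M f = bochner_integral M g"
proof -
  have "has_bochner M f I \<longleftrightarrow> has_bochner M g I" for I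
  proof -
    have "(AE x in M. (\<lambda>i. s i x) \<longlonglongrightarrow> f x) \<longleftrightarrow> (AE x in M. (\<lambda>i. s i x) \<longlonglongrightarrow> g x)"
      for s :: "nat \<Rightarrow> _"
      by (rule eventually_subst, rule eventually_mono[OF assms]) simp
    moreover have "(\<integral>\<^sup>+x. ennreal (norm (f x - u x)) \<partial>M) = (\<integral>\<^sup>+x. ennreal (norm (g x - u x)) \<partial>M)" for u
      using assms by (intro nn_integral_cong_AE) auto
    ultimately show ?thesis
      unfolding has_bochner_def strongly_measurable_def by simp
  qed
  then have "has_bochner M f = has_bochner M g" by (rule ext)
  then show ?thesis by (simp only: bochner_integral_def)
qed

section \<open>Lebesgue--Bochner spaces and operators on them\<close>

text \<open>
  Elements of $L^p$ are represented by functions, without passing to classes modulo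
  almost-everywhere equality: all notions below are invariant under changing a function
  on a null set. The underlying measure should be complete, so that strongly measurable
  functions have measurable norms. Norms are extended nonnegative reals, and the exponent
  ranges over \<open>[1, \<infinity>]\<close>.
\<close>

definition Lp_norm :: "ennreal \<Rightarrow> 'a measure \<Rightarrow> ('a \<Rightarrow> 'b::real_normed_vector) \<Rightarrow> ennreal" where
  "Lp_norm p M f =
     (if p = \<infinity> then esssup M (\<lambda>x. ennreal (norm (f x)))
      else let I = (\<integral>\<^sup>+x. ennreal (norm (f x) powr enn2real p) \<partial>M)
           in if I = \<infinity> then \<infinity> else ennreal (enn2real I powr (1 / enn2real p)))"

definition Lp_space :: "ennreal \<Rightarrow> 'a measure \<Rightarrow> ('a \<Rightarrow> 'b::real_normed_vector) set" where
  "Lp_space p M = {f. strongly_measurable M f \<and> Lp_norm p M f < \<infinity>}"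

definition Lp_opnorm ::
    "ennreal \<Rightarrow> 'a measure \<Rightarrow> (('a \<Rightarrow> 'b::real_normed_vector) \<Rightarrow> ('a \<Rightarrow> 'b)) \<Rightarrow> ennreal" where
  "Lp_opnorm p M T = (SUP f\<in>{f \<in> Lp_space p M. Lp_norm p M f \<le> 1}. Lp_norm p M (T f))"

definition RL_integral :: "real \<Rightarrow> real \<Rightarrow> (real \<Rightarrow> 'b::real_normed_vector) \<Rightarrow> real \<Rightarrow> 'b" where
  "RL_integral t0 \<alpha> f t =
     (1 / Gamma \<alpha>) *\<^sub>R bochner_integral (lebesgue_on {t0..t}) (\<lambda>s. (t - s) powr (\<alpha> - 1) *\<^sub>R f s)"

lemma RL_integral_cong_AE:
  assumes "AE s in lebesgue_on {t0..t1}. f s = g s" "t \<le> t1"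
  shows "RL_integral t0 \<alpha> f t = RL_integral t0 \<alpha> g t"
proof -
  have "AE s in lebesgue_on {t0..t}. f s = g s"
  proof -
    have "AE s in lebesgue. s \<in> {t0..t1} \<longrightarrow> f s = g s"
      using assms(1) by (simp add: AE_restrict_space_iff)
    then have "AE s in lebesgue. s \<in> {t0..t} \<longrightarrow> f s = g s"
      by (rule eventually_mono) (use assms(2) in simp)
    then show ?thesis by (simp add: AE_restrict_space_iff)
  qed
  then have "AE s in lebesgue_on {t0..t}.
      (t - s) powr (\<alpha> - 1) *\<^sub>R f s = (t - s) powr (\<alpha> - 1) *\<^sub>R g s"
    by (rule eventually_mono) simp
  from bochner_integral_cong_AE[OF this] show ?thesis
    unfolding RL_integral_def by (rule arg_cong)
qed

end

theory Submission
  imports Defs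
begin

text \<open>
  Concentrated bumps at the left end point defeat uniform continuity. Fix \<open>\<alpha> > 0\<close> and a vector \<open>v\<close>,
  and let \<open>f\<close> equal \<open>v\<close> on \<open>[t0, t0 + h]\<close> and vanish beyond. On that interval the fractional
  integral of \<open>f\<close> is \<open>(t - t0)\<^sup>\<alpha> / \<Gamma>(\<alpha> + 1)\<close> times \<open>v\<close> (lemma \<open>RL_integral_eq_on_bump\<close>), so its
  norm is at most half of that of \<open>v\<close> once \<open>h\<close> is small enough in terms of \<open>\<alpha>\<close>. Hence \<open>J f - f\<close>
  is pointwise at least half as large as \<open>f\<close>, for every exponent \<open>p\<close> at once. After
  normalising \<open>v\<close> so that \<open>f\<close> has \<open>L\<^sup>p\<close> norm one, the operator norm of \<open>J - Id\<close> is at least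
  \<open>1/2\<close> for every single \<open>\<alpha> > 0\<close> (lemma \<open>RL_opnorm_ge_half\<close>), so it cannot tend to zero.
\<close>

text \<open>
  Approximating simple functions of \<open>g\<close> stay simple, and stay approximating up to the factor
  \<open>norm v\<close>, when multiplied by the fixed vector \<open>v\<close>; thus integrals with values on a line reduce
  to real ones even when the Banach space is not separable.
\<close>
lemma bochner_integral_scaleR_left:
  fixes g :: "'a \<Rightarrow> real" and v :: "'b::real_normed_vector"
  assumes "integrable M g"
  shows "bochner_integral M (\<lambda>x. g x *\<^sub>R v) = integral\<^sup>L M g *\<^sub>R v"
proof (rule bochner_integral_eq)
  have "has_bochner_integral M g (integral\<^sup>L M g)"
    using assms by (rule has_bochner_integral_integrable)
  then show "has_bochner M (\<lambda>x. g x *\<^sub>R v) (integral\<^sup>L M g *\<^sub>R v)"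
  proof cases
    case (1 s)
    obtain u where u: "\<And>i. simple_function M (u i)"
        "\<And>x. x \<in> space M \<Longrightarrow> (\<lambda>i. u i x) \<longlonglongrightarrow> g x"
      using borel_measurable_implies_sequence_metric[OF 1(1), of 0] by blast
    have "simple_function M (\<lambda>x. u i x *\<^sub>R v)" for i
      using simple_function_compose1[OF u(1), of "\<lambda>r. r *\<^sub>R v"] .
    moreover have "AE x in M. (\<lambda>i. u i x *\<^sub>R v) \<longlonglongrightarrow> g x *\<^sub>R v"
      by (intro AE_I2 tendsto_intros u(2))
    ultimately have "strongly_measurable M (\<lambda>x. g x *\<^sub>R v)"
      unfolding strongly_measurable_def by (intro exI[of _ "\<lambda>i x. u i x *\<^sub>R v"]) blast
    moreover have "Bochner_Integration.simple_bochner_integrable M (\<lambda>x. s i x *\<^sub>R v)" for i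
      using simple_bochner_integrable_compose2[OF _ 1(2) 1(2), of "\<lambda>a b. a *\<^sub>R v"] by simp
    moreover have "(\<lambda>i. \<integral>\<^sup>+x. ennreal (norm (g x *\<^sub>R v - s i x *\<^sub>R v)) \<partial>M) \<longlonglongrightarrow> 0"
    proof -
      have meas: "s i \<in> borel_measurable M" for i
        using 1(2)[of i] by (auto elim!: simple_bochner_integrable.cases
            intro: borel_measurable_simple_function)
      have "(\<integral>\<^sup>+x. ennreal (norm (g x *\<^sub>R v - s i x *\<^sub>R v)) \<partial>M)
          = ennreal (norm v) * (\<integral>\<^sup>+x. ennreal (norm (g x - s i x)) \<partial>M)" for i
        using 1(1) meas
        by (subst nn_integral_cmult[symmetric])
           (auto intro!: nn_integral_cong
             simp: ennreal_mult[symmetric] mult.commute simp flip: scaleR_left_diff_distrib)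
      moreover have "(\<lambda>i. ennreal (norm v) * (\<integral>\<^sup>+x. ennreal (norm (g x - s i x)) \<partial>M))
          \<longlonglongrightarrow> ennreal (norm v) * 0"
        using 1(3) by (intro ennreal_tendsto_cmult) auto
      ultimately show ?thesis by simp
    qed
    moreover have "(\<lambda>i. Bochner_Integration.simple_bochner_integral M (\<lambda>x. s i x *\<^sub>R v))
        \<longlonglongrightarrow> integral\<^sup>L M g *\<^sub>R v"
    proof -
      have "Bochner_Integration.simple_bochner_integral M (\<lambda>x. s i x *\<^sub>R v)
          = Bochner_Integration.simple_bochner_integral M (s i) *\<^sub>R v" for i
        by (rule simple_bochner_integral_linear[OF bounded_linear.linear[OF
          bounded_linear_scaleR_left] 1(2)])
      then show ?thesis
        using 1(4) by (simp add: tendsto_scaleR)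
    qed
    ultimately show ?thesis
      unfolding has_bochner_def
      by (intro conjI exI[of _ "\<lambda>i x. s i x *\<^sub>R v"]) auto
  qed
qed

lemma
  fixes t0 t \<alpha> :: real
  assumes "0 < \<alpha>" "t0 \<le> t"
  shows integrable_RL_kernel: "integrable (lebesgue_on {t0..t}) (\<lambda>s. (t - s) powr (\<alpha> - 1))"
    and integral_RL_kernel:
      "integral\<^sup>L (lebesgue_on {t0..t}) (\<lambda>s. (t - s) powr (\<alpha> - 1)) = (t - t0) powr \<alpha> / \<alpha>"
proof -
  have "((\<lambda>s. (t - s) powr (\<alpha> - 1)) has_integral
      (- ((t - t) powr \<alpha> / \<alpha>) - - ((t - t0) powr \<alpha> / \<alpha>))) {t0..t}"
  proof (rule fundamental_theorem_of_calculus_interior)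
    show "continuous_on {t0..t} (\<lambda>s. - ((t - s) powr \<alpha> / \<alpha>))"
      using assms by (intro continuous_intros continuous_on_powr') auto
    show "((\<lambda>s. - ((t - s) powr \<alpha> / \<alpha>)) has_vector_derivative (t - s) powr (\<alpha> - 1)) (at s)"
      if "s \<in> {t0<..<t}" for s
      using that assms unfolding has_real_derivative_iff_has_vector_derivative[symmetric]
      by (auto intro!: derivative_eq_intros simp: powr_diff)
  qed (use assms in auto)
  then have I: "((\<lambda>s. (t - s) powr (\<alpha> - 1)) has_integral (t - t0) powr \<alpha> / \<alpha>) {t0..t}"
    using assms by simp
  then have abs: "(\<lambda>s. (t - s) powr (\<alpha> - 1)) absolutely_integrable_on {t0..t}"
    by (intro nonnegative_absolutely_integrable_1) (auto simp: has_integral_integrable)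
  then show int: "integrable (lebesgue_on {t0..t}) (\<lambda>s. (t - s) powr (\<alpha> - 1))"
    by (simp add: integrable_restrict_space set_integrable_def)
  show "integral\<^sup>L (lebesgue_on {t0..t}) (\<lambda>s. (t - s) powr (\<alpha> - 1)) = (t - t0) powr \<alpha> / \<alpha>"
    using lebesgue_integral_eq_integral[OF int] I by (simp add: integral_unique)
qed

text \<open>
  Up to time \<open>t0 + h\<close> the operator only sees the constant \<open>v\<close>, so its value is the classical
  fractional integral of a constant; the factor \<open>1/\<alpha>\<close> of the kernel's integral turns
  \<open>\<Gamma>(\<alpha>)\<close> into \<open>\<Gamma>(\<alpha> + 1)\<close>.
\<close>
lemma RL_integral_eq_on_bump:
  fixes v :: "'b::real_normed_vector"
  assumes "0 < \<alpha>" "t \<in> {t0..t0 + h}"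
  shows "RL_integral t0 \<alpha> (\<lambda>s. indicator {t0..t0 + h} s *\<^sub>R v) t
    = ((t - t0) powr \<alpha> / Gamma (\<alpha> + 1)) *\<^sub>R v"
proof -
  have "RL_integral t0 \<alpha> (\<lambda>s. indicator {t0..t0 + h} s *\<^sub>R v) t = RL_integral t0 \<alpha> (\<lambda>_. v) t"
    using assms by (intro RL_integral_cong_AE[where ?t1.0 = t]) (auto intro!: AE_I2)
  also have "\<dots> = (1 / Gamma \<alpha>) *\<^sub>R (((t - t0) powr \<alpha> / \<alpha>) *\<^sub>R v)"
    using assms unfolding RL_integral_def
    by (subst bochner_integral_scaleR_left) (auto simp: integrable_RL_kernel integral_RL_kernel)
  also have "\<dots> = ((t - t0) powr \<alpha> / Gamma (\<alpha> + 1)) *\<^sub>R v"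
    using assms(1) by (simp add: Gamma_plus1[of \<alpha>] nonpos_Ints_def mult.commute)
  finally show ?thesis .
qed

text \<open>
  For \<open>p = \<infinity>\<close> the exponent \<open>1 / enn2real p\<close> is \<open>1 / 0 = 0\<close>, so that the right-hand side is
  \<open>norm v\<close>, as it should be; this is where positivity of the measure of \<open>A\<close> enters.
\<close>
lemma Lp_norm_indicator_scaleR:
  fixes v :: "'b::real_normed_vector"
  assumes A: "A \<in> sets M" "emeasure M A = ennreal m" "0 < m" and "1 \<le> p"
  shows "Lp_norm p M (\<lambda>x. indicator A x *\<^sub>R v) = ennreal (norm v * m powr (1 / enn2real p))"
proof (cases "p = \<infinity>")
  case True
  define g where "g x = ennreal (norm (indicator A x *\<^sub>R v))" for x
  have "g = (\<lambda>x. ennreal (norm v) * indicator A x)"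
    by (auto simp: g_def indicator_def)
  then have [measurable]: "g \<in> borel_measurable M"
    using A(1) by simp
  have "esssup M g \<le> ennreal (norm v)"
    by (intro esssup_I AE_I2) (auto simp: g_def indicator_def)
  moreover have "ennreal (norm v) \<le> esssup M g"
  proof (rule ccontr)
    assume *: "\<not> ennreal (norm v) \<le> esssup M g"
    have "AE x in M. g x \<le> esssup M g" by (rule esssup_AE)
    then have "AE x in M. x \<notin> A"
      by eventually_elim (use * in \<open>auto simp: g_def\<close>)
    then have "emeasure M A = 0"
      using A(1) AE_iff_measurable[of A M "\<lambda>x. x \<notin> A"] sets.sets_into_space[OF A(1)] by auto
    then show False using A by simp
  qed
  ultimately show ?thesis
    using True A(3) by (simp add: Lp_norm_def g_def[abs_def])
next
  case False
  define q where "q = enn2real p"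
  have q: "0 < q"
    using False assms(4) unfolding q_def
    by (metis enn2real_positive_iff infinity_ennreal_def less_le_trans top.not_eq_extremum zero_less_one)
  have "(\<integral>\<^sup>+x. ennreal (norm (indicator A x *\<^sub>R v) powr q) \<partial>M)
      = (\<integral>\<^sup>+x. ennreal (norm v powr q) * indicator A x \<partial>M)"
    using q by (intro nn_integral_cong) (auto simp: indicator_def)
  also have "\<dots> = ennreal (norm v powr q * m)"
    using A by (simp add: nn_integral_cmult_indicator ennreal_mult)
  finally show ?thesis
    using False q A(3) by (simp add: Lp_norm_def Let_def powr_mult powr_powr flip: q_def)
qed

text \<open>
  Measurability is asked only of the smaller function: a lower integral is monotone anyway, and
  the essential supremum of a non-measurable function is \<open>\<infinity>\<close> by convention. So \<open>g\<close> may be a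
  fractional integral whose measurability has not been established.
\<close>
lemma Lp_norm_mono:
  assumes "\<And>x. x \<in> space M \<Longrightarrow> norm (f x) \<le> norm (g x)"
    and "(\<lambda>x. norm (f x)) \<in> borel_measurable M"
  shows "Lp_norm p M f \<le> Lp_norm p M g"
proof (cases "p = \<infinity>")
  case True
  then show ?thesis
    unfolding Lp_norm_def
    using assms by (auto intro!: esssup_AE_mono AE_I2 ennreal_leI)
next
  case False
  define q where "q = enn2real p"
  have "(\<integral>\<^sup>+x. ennreal (norm (f x) powr q) \<partial>M) \<le> (\<integral>\<^sup>+x. ennreal (norm (g x) powr q) \<partial>M)"
    using assms(1) by (intro nn_integral_mono ennreal_leI powr_mono2) (auto simp: q_def)
  then show ?thesis
    using False unfolding Lp_norm_def Let_def q_def[symmetric]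
    by (auto intro!: ennreal_leI powr_mono2 enn2real_mono simp: top_unique less_top q_def)
qed

text \<open>
  The bump may be chosen as narrow as \<open>\<alpha>\<close> demands because the factor \<open>h powr (- 1 / p)\<close> in \<open>v\<close>
  restores its norm; hence the bound does not deteriorate with \<open>\<alpha>\<close>.
\<close>
lemma RL_opnorm_ge_half:
  fixes e :: "'x::real_normed_vector"
  assumes "t0 < t1" "1 \<le> p" "e \<noteq> 0" "0 < \<alpha>"
  shows "ennreal (1/2) \<le> Lp_opnorm p (lebesgue_on {t0..t1})
    (\<lambda>(f :: real \<Rightarrow> 'x) t. RL_integral t0 \<alpha> f t - f t)"
proof -
  let ?M = "lebesgue_on {t0..t1}"
  have G: "0 < Gamma (\<alpha> + 1)"
    using assms by (intro Gamma_real_pos) simp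
  (* the second bound on h makes h powr \<alpha> / Gamma (\<alpha> + 1), the largest factor by which the
     fractional integral multiplies v on the bump, at most 1/2 *)
  define h where "h = min (t1 - t0) ((Gamma (\<alpha> + 1) / 2) powr (1 / \<alpha>))"
  have h: "0 < h" "h \<le> t1 - t0" using assms less_imp_neq[OF G, symmetric] by (simp_all add: h_def)
  have "h powr \<alpha> \<le> ((Gamma (\<alpha> + 1) / 2) powr (1 / \<alpha>)) powr \<alpha>"
    using assms h by (intro powr_mono2) (auto simp: h_def)
  then have small: "h powr \<alpha> \<le> Gamma (\<alpha> + 1) / 2"
    using assms G by (simp add: powr_powr)
  define A where "A = {t0..t0 + h}"
  have "emeasure ?M A = ennreal h" and A: "A \<in> sets ?M"
    using h by (auto simp: A_def emeasure_restrict_space sets_restrict_space_iff)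
  note Lp_norm_A = Lp_norm_indicator_scaleR[OF A this(1) h(1) assms(2)]
  define v where "v = (h powr (- (1 / enn2real p)) / norm e) *\<^sub>R e"
  have norm_v: "norm v = h powr (- (1 / enn2real p))"
    using assms by (simp add: v_def)
  have v: "norm v * h powr (1 / enn2real p) = 1"
    using h unfolding norm_v by (simp flip: powr_add)
  define f where "f s = indicator A s *\<^sub>R v" for s :: real
  have norm_f: "Lp_norm p ?M f = 1"
    unfolding f_def[abs_def] Lp_norm_A v by simp
  have "simple_function ?M f"
    unfolding f_def[abs_def]
    using simple_function_compose1[OF simple_function_indicator[OF A], of "\<lambda>r. r *\<^sub>R v"] .
  then have "strongly_measurable ?M f"
    unfolding strongly_measurable_def by (intro exI[of _ "\<lambda>_. f"]) simp
  then have f: "f \<in> {f \<in> Lp_space p ?M. Lp_norm p ?M f \<le> 1}"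
    by (simp add: Lp_space_def norm_f)
  have half_le: "norm (indicator A t *\<^sub>R ((1/2) *\<^sub>R v)) \<le> norm (RL_integral t0 \<alpha> f t - f t)" for t
  proof (cases "t \<in> A")
    case True
    define r where "r = (t - t0) powr \<alpha> / Gamma (\<alpha> + 1)"
    have "(t - t0) powr \<alpha> \<le> h powr \<alpha>"
      using True assms by (intro powr_mono2) (auto simp: A_def)
    then have r: "r \<le> 1/2"
      using small G by (simp add: r_def field_simps)
    have "RL_integral t0 \<alpha> f t - f t = (r - 1) *\<^sub>R v"
      using True RL_integral_eq_on_bump[OF assms(4), of t t0 h v]
      by (simp add: f_def[abs_def] A_def r_def scaleR_left_diff_distrib)
    moreover have "1/2 * norm v \<le> \<bar>r - 1\<bar> * norm v"
      using r by (intro mult_right_mono) auto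
    ultimately show ?thesis
      using True by simp
  qed simp
  have "ennreal (1/2) = Lp_norm p ?M (\<lambda>t. indicator A t *\<^sub>R ((1/2) *\<^sub>R v))"
    unfolding Lp_norm_A using v by simp
  also have "\<dots> \<le> Lp_norm p ?M (\<lambda>t. RL_integral t0 \<alpha> f t - f t)"
  proof (rule Lp_norm_mono)
    show "(\<lambda>x. norm (indicator A x *\<^sub>R (1/2) *\<^sub>R v)) \<in> borel_measurable ?M"
      using A by simp
  qed (rule half_le)
  also have "\<dots> \<le> Lp_opnorm p ?M (\<lambda>(f :: real \<Rightarrow> 'x) t. RL_integral t0 \<alpha> f t - f t)"
    unfolding Lp_opnorm_def using f by (rule SUP_upper)
  finally show ?thesis .
qed

theorem corollary31:
  fixes t0 t1 :: real and p :: ennreal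
  assumes "t0 < t1"
    and "1 \<le> p"
    and "\<exists>x::'x::banach. x \<noteq> 0"
  shows "\<not> ((\<lambda>\<alpha>. Lp_opnorm p (lebesgue_on {t0..t1})
                 (\<lambda>(f :: real \<Rightarrow> 'x) t. RL_integral t0 \<alpha> f t - f t)) \<longlongrightarrow> 0) (at_right 0)"
    (is "\<not> (?N \<longlongrightarrow> 0) _")
proof
  assume lim: "(?N \<longlongrightarrow> 0) (at_right 0)"
  obtain e :: 'x where "e \<noteq> 0" using assms(3) by blast
  with assms(1,2) have "\<forall>\<^sub>F \<alpha> in at_right 0. ennreal (1/2) \<le> ?N \<alpha>"
    by (intro eventually_at_right_less[THEN eventually_mono] RL_opnorm_ge_half)
  then have "ennreal (1/2) \<le> 0"
    by (rule tendsto_lowerbound[OF lim]) simp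
  then show False by simp
qed

end
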